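(* Let $N\ge2$, $s\in(1/2,1)$, and let $V\colon(0,+\infty)\to[0,+\infty)$ and $K\colon(0,+\infty)\to(0,+\infty)$ be continuous. Assume there exists $R_2>0$ such that \[ \sup_{r>R_2}\frac{K(r)}{r^{\alpha_\infty}V(r)^{\beta_\infty}}<+\infty \] for some $0\le\beta_\infty\le1$ and $\alpha_\infty\in\mathbb{R}$. Then $\lim_{R\to+\infty}\mathcal S_\infty(q_2,R)=0$ for every $q_2\in\mathbb{R}$ such that $q_2>\max\{1,2\beta_\infty,q^*(\alpha_\infty,\beta_\infty,s)\}$.
   Context: $q^*(\alpha,\beta,s)=2\frac{\alpha-2s\beta+N}{N-2s}$. $B_R^c$ is the complement of the open ball of radius $R$ centered at $0$. For $0<s<1$, $2^*_s=\frac{2N}{N-2s}$, $C(N,s)=\left(\int_{\mathbb{R}^N}\frac{1-\cos\zeta_1}{|\zeta|^{N+2s}}d\zeta\right)^{-1}$, $[u]_{H^s}=\left(\frac{C(N,s)}{2}\iint\frac{|u(x)-u(y)|^2}{|x-y|^{N+2s}}dx\,dy\right)^{1/2}$, $\dot H^s(\mathbb{R}^N)=\{u\in L^{2^*_s}:[u]_{H^s}<\infty\}$, $H^s_V(\mathbb{R}^N)=\{u\in\dot H^s:\int V(|x|)|u|^2<\infty\}$ with norm $\|u\|^2=[u]_{H^s}^2+\int V(|x|)|u|^2dx$, $H^s_{V,\mathrm{rad}}$ its radial subspace. $\mathcal S_\infty(q,R)=\sup\{\int_{B_R^c}K(|x|)|u|^qdx:u\in H^s_{V,\mathrm{rad}},\|u\|=1\}$.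 The convention $V^0=1$ is used. *)

theory Defs
  imports "HOL-Analysis.Analysis"
begin

definition qstar :: "nat \<Rightarrow> real \<Rightarrow> real \<Rightarrow> real \<Rightarrow> real" where
  "qstar N \<alpha> \<beta> s = 2 * (\<alpha> - 2 * s * \<beta> + real N) / (real N - 2 * s)"

definition frac_crit :: "nat \<Rightarrow> real \<Rightarrow> real" where
  "frac_crit N s = 2 * real N / (real N - 2 * s)"

definition vpow :: "(real \<Rightarrow> real) \<Rightarrow> real \<Rightarrow> real \<Rightarrow> real" where
  "vpow V \<beta> r = (if \<beta> = 0 then 1 else V r powr \<beta>)"

text \<open>The constant C(N,s); zeta_1 is the first coordinate, i.e. the component along
  a fixed basis vector.\<close>
definition CNs :: "'a::euclidean_space itself \<Rightarrow> real \<Rightarrow> real" where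
  "CNs _ s = inverse (enn2real (\<integral>\<^sup>+ \<zeta>. ennreal ((1 - cos (\<zeta> \<bullet> (SOME b. b \<in> (Basis::'a set))))
        / norm \<zeta> powr (real DIM('a) + 2 * s)) \<partial>(lborel :: 'a measure)))"

definition gagliardo_sq :: "real \<Rightarrow> ('a::euclidean_space \<Rightarrow> real) \<Rightarrow> ennreal" where
  "gagliardo_sq s u = ennreal (CNs TYPE('a) s / 2) *
     (\<integral>\<^sup>+ p. ennreal ((u (fst p) - u (snd p))\<^sup>2 / norm (fst p - snd p) powr (real DIM('a) + 2 * s))
        \<partial>(lborel \<Otimes>\<^sub>M lborel))"

definition in_Hdot :: "real \<Rightarrow> ('a::euclidean_space \<Rightarrow> real) \<Rightarrow> bool" where
  "in_Hdot s u \<longleftrightarrow> u \<in> borel_measurable lborel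
     \<and> (\<integral>\<^sup>+ x. ennreal (\<bar>u x\<bar> powr frac_crit DIM('a) s) \<partial>lborel) < \<infinity>
     \<and> gagliardo_sq s u < \<infinity>"

definition V_part :: "(real \<Rightarrow> real) \<Rightarrow> ('a::euclidean_space \<Rightarrow> real) \<Rightarrow> ennreal" where
  "V_part V u = (\<integral>\<^sup>+ x. ennreal (V (norm x) * (u x)\<^sup>2) \<partial>lborel)"

definition in_HsV :: "(real \<Rightarrow> real) \<Rightarrow> real \<Rightarrow> ('a::euclidean_space \<Rightarrow> real) \<Rightarrow> bool" where
  "in_HsV V s u \<longleftrightarrow> in_Hdot s u \<and> V_part V u < \<infinity>"

definition radial :: "('a::real_normed_vector \<Rightarrow> real) \<Rightarrow> bool" where
  "radial u \<longleftrightarrow> (\<forall>x y. norm x = norm y \<longrightarrow> u x = u y)"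

definition HsV_normsq :: "(real \<Rightarrow> real) \<Rightarrow> real \<Rightarrow> ('a::euclidean_space \<Rightarrow> real) \<Rightarrow> ennreal" where
  "HsV_normsq V s u = gagliardo_sq s u + V_part V u"

definition S_inf :: "'a::euclidean_space itself \<Rightarrow> (real \<Rightarrow> real) \<Rightarrow> (real \<Rightarrow> real) \<Rightarrow> real \<Rightarrow> real \<Rightarrow> real \<Rightarrow> ennreal" where
  "S_inf _ V K s q R = Sup { (\<integral>\<^sup>+ x. ennreal (indicator {x. R \<le> norm x} x * K (norm x) * \<bar>u x\<bar> powr q) \<partial>(lborel :: 'a measure))
      | u :: 'a \<Rightarrow> real. radial u \<and> in_HsV V s u \<and> HsV_normsq V s u = 1 }"

end

theory Submission
  imports Defs
begin

text \<open>The heart of the matter is the radial estimate |u(x)| <= C [u] |x|^(-(N-2s)/2) for almost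
  every x, valid for s > 1/2. It comes from comparing the means of u over the balls
  B(x, d) and B(x, 2d): their squared difference is at most C d^(2s-N) times the Gagliardo energy
  of u on B(x, 2d) x B(x, 2d). For d >= |x| that energy is bounded by the total one; for
  d < |x| radial symmetry allows it to be averaged over an annulus, which gains a factor
  (d/|x|)^(N-1). In both regimes the differences over dyadic d form a geometric series (for small d
  because s > 1/2), the means tend to 0 as d grows since u is in L^p for some p, and
  they tend to u(x) as d shrinks whenever the Gagliardo integral in y alone is finite at x.

  With this decay, the weighted AM-GM inequality bounds K |u|^q by
  C R^(-t) (V u^2 + |x|^(-N-t)) on |x| >= R for some t > 0, and the bracket has bounded integral.\<close>

section \<open>Linear isometries\<close>

lemma nn_integral_lborel_translate:
  fixes g :: "'a::euclidean_space \<Rightarrow> ennreal"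
  assumes [measurable]: "g \<in> borel_measurable borel"
  shows "(\<integral>\<^sup>+x. g (c + x) \<partial>lborel) = (\<integral>\<^sup>+x. g x \<partial>lborel)"
  by (subst (2) lborel_distr_plus[of c, symmetric]) (simp add: nn_integral_distr)

text \<open>The uniqueness argument for Haar measure: the integral of 1_B(y) g(f(x)) over x and y, with B the
  unit ball, is evaluated in two ways.\<close>

lemma nn_integral_lborel_linear_isometry:
  fixes f :: "'a::euclidean_space \<Rightarrow> 'a"
  assumes f: "linear f" "\<And>x. norm (f x) = norm x"
    and [measurable]: "g \<in> borel_measurable borel"
  shows "(\<integral>\<^sup>+x. g (f x) \<partial>lborel) = (\<integral>\<^sup>+x. g x \<partial>lborel)"
proof -
  have "inj f"
    using f by (metis linear_injective_0 norm_eq_zero)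
  then have surj: "surj f"
    using f(1) linear_injective_imp_surjective by blast
  have [measurable]: "f \<in> borel_measurable borel"
    using f(1) by (intro borel_measurable_continuous_onI linear_continuous_on linear_conv_bounded_linear[THEN iffD1])
  define B where "B = ball (0::'a) 1"
  define v where "v = emeasure lborel B"
  have [measurable]: "B \<in> sets borel" by (simp add: B_def)
  have v: "v \<noteq> 0" "v \<noteq> \<infinity>"
    using content_ball_pos[of 1 "0::'a"] emeasure_lborel_ball_finite[of "0::'a" 1]
    by (auto simp: v_def B_def measure_def)
  \<comment> \<open>Translating by \<open>y\<close> after \<open>f\<close> is the same as
    translating by the preimage \<open>w\<close> before it, and this leaves the integral over
    \<open>x\<close> unchanged. Surjectivity of \<open>f\<close> supplies \<open>w\<close>.\<close>
  have shift: "(\<integral>\<^sup>+x. g (f x) \<partial>lborel) = (\<integral>\<^sup>+x. g (f x + y) \<partial>lborel)" for y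
  proof -
    obtain w where w: "y = f w" using surj by blast
    show ?thesis
      using nn_integral_lborel_translate[of "\<lambda>x. g (f x)" w]
      by (simp add: w linear_add[OF f(1)] add.commute)
  qed
  \<comment> \<open>Since \<open>f\<close> preserves distances, the points \<open>x\<close> counted
    here form the unit ball around the preimage of \<open>z\<close>.\<close>
  have ball: "(\<integral>\<^sup>+x. indicator B (z - f x) \<partial>lborel) = v" for z
  proof -
    obtain w where w: "z = f w" using surj by blast
    have "z - f x \<in> B \<longleftrightarrow> x \<in> ball w 1" for x
      by (simp add: w B_def dist_norm f(2) flip: linear_diff[OF f(1)])
    then have "(\<integral>\<^sup>+x. indicator B (z - f x) \<partial>lborel) = emeasure lborel (ball w 1)"
      by (simp add: indicator_def flip: nn_integral_indicator)
    also have "\<dots> = v" by (simp add: v_def B_def emeasure_ball)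
    finally show ?thesis .
  qed
  have "v * (\<integral>\<^sup>+x. g (f x) \<partial>lborel) = (\<integral>\<^sup>+y. indicator B y * (\<integral>\<^sup>+x. g (f x + y) \<partial>lborel) \<partial>lborel)"
    by (subst shift[symmetric]) (simp add: nn_integral_multc v_def)
  also have "\<dots> = (\<integral>\<^sup>+x. (\<integral>\<^sup>+y. indicator B y * g (f x + y) \<partial>lborel) \<partial>lborel)"
    by (simp flip: nn_integral_cmult) (rule lborel_pair.Fubini', measurable)
  \<comment> \<open>Inner substitution \<open>z = f x + y\<close>. After a further exchange of
    integrals, \<open>x\<close> occurs only in the indicator evaluated by
    \<open>ball\<close>.\<close>
  also have "\<dots> = (\<integral>\<^sup>+x. (\<integral>\<^sup>+z. indicator B (z - f x) * g z \<partial>lborel) \<partial>lborel)"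
    using nn_integral_lborel_translate[of "\<lambda>z. indicator B (z - f x) * g z" "f x" for x]
    by simp
  also have "\<dots> = (\<integral>\<^sup>+z. (\<integral>\<^sup>+x. indicator B (z - f x) * g z \<partial>lborel) \<partial>lborel)"
    by (rule lborel_pair.Fubini') measurable
  also have "\<dots> = v * (\<integral>\<^sup>+z. g z \<partial>lborel)"
    by (simp add: nn_integral_multc ball nn_integral_cmult)
  finally show ?thesis
    using v by (simp add: ennreal_mult_cancel_left)
qed

lemma linear_isometry_exists:
  fixes a b :: "'a::euclidean_space"
  assumes "norm a = norm b"
  obtains f where "linear f" "\<And>x. norm (f x) = norm x" "f a = b"
proof (cases "a = b")
  case True
  then show ?thesis using that[of id] by (simp add: linear_id)
next
  case False
  \<comment> \<open>the reflection exchanging a and b\<close>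
  define w where "w = a - b"
  define f where "f x = x - (2 * (x \<bullet> w) / (w \<bullet> w)) *\<^sub>R w" for x
  have w: "w \<bullet> w \<noteq> 0" using False by (simp add: w_def)
  have "linear f"
    by (rule linearI) (simp_all add: f_def algebra_simps inner_simps add_divide_distrib)
  moreover have "norm (f x) = norm x" for x
    unfolding norm_eq_sqrt_inner using w
    by (simp add: f_def inner_simps inner_commute field_simps)
  \<comment> \<open>Equal norms give
    \<open>w \<bullet> w = 2 * (a \<bullet> a) - 2 * (a \<bullet> b)\<close>. Hence the coefficient
    of \<open>w\<close> in \<open>f a\<close> is 1 and \<open>f a = a - w\<close>.\<close>
  moreover have "2 * (a \<bullet> w) = w \<bullet> w"
    using assms by (simp add: w_def inner_simps norm_eq inner_commute)
  then have "f a = b"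
    using w by (simp add: f_def) (simp add: w_def)
  ultimately show ?thesis using that by blast
qed

section \<open>Local Gagliardo energy of radial functions\<close>

definition gag_kernel :: "real \<Rightarrow> ('a::euclidean_space \<Rightarrow> real) \<Rightarrow> 'a \<Rightarrow> 'a \<Rightarrow> real" where
  "gag_kernel p u y z = (u y - u z)\<^sup>2 / norm (y - z) powr p"

text \<open>Indicators of distances, rather than of a ball around \<open>x\<close>, make joint
  measurability in the centre and both variables apparent; Fubini's theorem is later applied with
  the centre as a variable.\<close>

definition local_energy :: "real \<Rightarrow> ('a::euclidean_space \<Rightarrow> real) \<Rightarrow> 'a \<Rightarrow> real \<Rightarrow> ennreal" where
  "local_energy p u x d = (\<integral>\<^sup>+y. \<integral>\<^sup>+z. indicator {..<d} (dist x y) * indicator {..<d} (dist x z)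
     * ennreal (gag_kernel p u y z) \<partial>lborel \<partial>lborel)"

text \<open>For \<open>p = N + 2 * s\<close> this is the squared Gagliardo seminorm without its
  normalising constant, as an iterated integral.\<close>

definition energy :: "real \<Rightarrow> ('a::euclidean_space \<Rightarrow> real) \<Rightarrow> ennreal" where
  "energy p u = (\<integral>\<^sup>+y. \<integral>\<^sup>+z. ennreal (gag_kernel p u y z) \<partial>lborel \<partial>lborel)"

lemma gag_kernel_nonneg [simp]: "gag_kernel p u y z \<ge> 0"
  by (simp add: gag_kernel_def)

lemma measurable_gag_kernel [measurable (raw)]:
  assumes [measurable]: "u \<in> borel_measurable borel" "f \<in> borel_measurable M" "g \<in> borel_measurable M"
  shows "(\<lambda>x. gag_kernel p u (f x) (g x)) \<in> borel_measurable M"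
  unfolding gag_kernel_def by measurable

lemma local_energy_le: "local_energy p u x d \<le> energy p u"
  unfolding local_energy_def energy_def
  by (intro nn_integral_mono) (auto simp: indicator_def)

lemma local_energy_mono:
  assumes "dist x w \<le> e"
  shows "local_energy p u x d \<le> local_energy p u w (d + e)"
proof -
  have *: "dist w y < d + e" if "dist x y < d" for y
    using that assms dist_triangle[of w y x] by (simp add: dist_commute)
  show ?thesis
    unfolding local_energy_def by (intro nn_integral_mono) (auto simp: indicator_def *)
qed

text \<open>A linear isometry taking \<open>x\<close> to \<open>x'\<close> carries one ball to the
  other, leaves the kernel of a radial function unchanged and preserves Lebesgue measure in each
  variable.\<close>

lemma local_energy_radial:
  fixes u :: "'a::euclidean_space \<Rightarrow> real"
  assumes [measurable]: "u \<in> borel_measurable borel" and u: "radial u" and "norm x = norm x'"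
  shows "local_energy p u x d = local_energy p u x' d"
proof -
  obtain f where f: "linear f" "\<And>x. norm (f x) = norm x" "f x = x'"
    using linear_isometry_exists[OF assms(3)] by metis
  have [simp]: "dist (f a) (f b) = dist a b" for a b
    by (simp add: dist_norm f(2) flip: linear_diff[OF f(1)])
  have uf: "u (f a) = u a" for a
    using u f(2) unfolding radial_def by blast
  have gf: "gag_kernel p u (f a) (f b) = gag_kernel p u a b" for a b
    by (simp add: gag_kernel_def uf f(2) flip: linear_diff[OF f(1)])
  let ?F = "\<lambda>x y z. indicator {..<d} (dist x y) * indicator {..<d} (dist x z) * ennreal (gag_kernel p u y z)"
  have "local_energy p u x' d = (\<integral>\<^sup>+y. \<integral>\<^sup>+z. ?F x' (f y) z \<partial>lborel \<partial>lborel)"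
    unfolding local_energy_def
    by (rule nn_integral_lborel_linear_isometry[OF f(1,2), symmetric]) measurable
  also have "\<dots> = (\<integral>\<^sup>+y. \<integral>\<^sup>+z. ?F x' (f y) (f z) \<partial>lborel \<partial>lborel)"
    by (intro nn_integral_cong nn_integral_lborel_linear_isometry[OF f(1,2), symmetric]) measurable
  also have "\<dots> = local_energy p u x d"
    by (simp add: local_energy_def f(3)[symmetric] gf)
  finally show ?thesis ..
qed

section \<open>Averaging the local energy over an annulus\<close>

text \<open>Rests on \<open>(r + d) ^ N - r ^ N \<ge> d * r ^ (N - 1)\<close>. The factor
  \<open>r ^ (N - 1)\<close> is the source of the gain for radial functions.\<close>

lemma annulus_measure_ge:
  assumes "0 \<le> r" "0 \<le> d"
  shows "emeasure lborel {w::'a::euclidean_space. r \<le> norm w \<and> norm w < r + d}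
     \<ge> ennreal (unit_ball_vol DIM('a) * (d * r ^ (DIM('a) - 1)))"
proof -
  let ?n = "DIM('a)" and ?v = "unit_ball_vol DIM('a)"
  have A: "{w::'a. r \<le> norm w \<and> norm w < r + d} = ball 0 (r + d) - ball 0 r"
    by auto
  have sub: "ball (0::'a) r \<subseteq> ball 0 (r + d)"
    using assms by (simp add: subset_ball)
  obtain m where m: "?n = Suc m" using DIM_positive[where 'a='a] by (cases ?n) auto
  have "r ^ ?n + d * r ^ m = (r + d) * r ^ m"
    by (simp add: m algebra_simps)
  also have "\<dots> \<le> (r + d) * (r + d) ^ m"
    using assms by (intro mult_left_mono power_mono) auto
  finally have le: "d * r ^ m \<le> (r + d) ^ ?n - r ^ ?n" by (simp add: m)
  have "emeasure lborel (ball (0::'a) (r + d) - ball 0 r)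
      = emeasure lborel (ball (0::'a) (r + d)) - emeasure lborel (ball (0::'a) r)"
    using emeasure_lborel_ball_finite[of "0::'a" r] sub by (intro emeasure_Diff) auto
  also have "\<dots> = ennreal (?v * ((r + d) ^ ?n - r ^ ?n))"
    using assms by (simp add: emeasure_ball right_diff_distrib ennreal_minus)
  also have "\<dots> \<ge> ennreal (?v * (d * r ^ m))"
    using le by (intro ennreal_leI mult_left_mono) auto
  finally show ?thesis unfolding A by (simp add: m)
qed

text \<open>For w in an annulus around the sphere through x, some rotation of B(x, d) lies in
  B(w, 2d). Integrating over the annulus and applying Fubini's theorem gives the bound.\<close>

lemma local_energy_radial_le:
  fixes u :: "'a::euclidean_space \<Rightarrow> real"
  assumes [measurable]: "u \<in> borel_measurable borel" and u: "radial u" and "x \<noteq> 0" "d > 0"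
  shows "local_energy p u x d \<le> ennreal (2 ^ DIM('a) * (d / norm x) ^ (DIM('a) - 1)) * energy p u"
proof -
  define r where "r = norm x"
  have r: "r > 0" using assms by (simp add: r_def)
  define n where "n = DIM('a)"
  define v where "v = unit_ball_vol DIM('a)"
  have v: "v > 0" by (simp add: v_def)
  define A where "A = {w::'a. r \<le> norm w \<and> norm w < r + d}"
  have [measurable]: "A \<in> sets borel" unfolding A_def by measurable
  have le: "local_energy p u x d \<le> local_energy p u w (2 * d)" if "w \<in> A" for w
  proof -
    \<comment> \<open>The radial projection of \<open>w\<close> to the sphere through
      \<open>x\<close>; its distance to \<open>w\<close> is \<open>norm w - r\<close>, which is
      below \<open>d\<close>.\<close>
    define x' where "x' = (r / norm w) *\<^sub>R w"
    have w: "norm w > 0" "r \<le> norm w" "norm w < r + d" using that r by (auto simp: A_def)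
    have nx': "norm x' = norm x" using w r by (simp add: x'_def r_def)
    have "x' - w = (r / norm w - 1) *\<^sub>R w" by (simp add: x'_def algebra_simps)
    then have "dist x' w = \<bar>r / norm w - 1\<bar> * norm w" by (simp add: dist_norm)
    also have "\<dots> = norm w - r"
      using w r by (simp add: abs_if field_simps)
    finally have "dist x' w \<le> d" using w by simp
    then have "local_energy p u x' d \<le> local_energy p u w (d + d)" by (rule local_energy_mono)
    then show ?thesis using local_energy_radial[OF assms(1) u nx', of p d] by simp
  qed
  let ?F = "\<lambda>w y z. indicator {..<2*d} (dist w y) * indicator {..<2*d} (dist w z) * ennreal (gag_kernel p u y z)"
  \<comment> \<open>Only one indicator is kept: a pair \<open>(y, z)\<close> is seen only from
    centres \<open>w\<close> within \<open>2 * d\<close> of \<open>y\<close>.\<close>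
  have vol: "(\<integral>\<^sup>+w. ?F w y z \<partial>lborel) \<le> ennreal (v * (2 * d) ^ n) * ennreal (gag_kernel p u y z)" for y z
  proof -
    have "(\<integral>\<^sup>+w. ?F w y z \<partial>lborel) \<le> (\<integral>\<^sup>+w. indicator (ball y (2*d)) w * ennreal (gag_kernel p u y z) \<partial>lborel)"
      by (intro nn_integral_mono) (auto simp: indicator_def dist_commute)
    also have "\<dots> = ennreal (v * (2 * d) ^ n) * ennreal (gag_kernel p u y z)"
      using assms by (subst nn_integral_multc) (auto intro!: borel_measurable_indicator simp: emeasure_ball v_def n_def)
    finally show ?thesis .
  qed
  have "ennreal (v * (d * r ^ (n - 1))) * local_energy p u x d \<le> emeasure lborel A * local_energy p u x d"
    unfolding v_def n_def A_def using r assms by (intro mult_right_mono annulus_measure_ge) auto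
  also have "\<dots> = (\<integral>\<^sup>+w. indicator A w * local_energy p u x d \<partial>lborel)"
    by (simp add: nn_integral_multc)
  also have "\<dots> \<le> (\<integral>\<^sup>+w. local_energy p u w (2 * d) \<partial>lborel)"
    by (intro nn_integral_mono) (auto simp: indicator_def le)
  also have "\<dots> = (\<integral>\<^sup>+y. (\<integral>\<^sup>+w. (\<integral>\<^sup>+z. ?F w y z \<partial>lborel) \<partial>lborel) \<partial>lborel)"
    unfolding local_energy_def by (rule lborel_pair.Fubini') measurable
  also have "\<dots> = (\<integral>\<^sup>+y. (\<integral>\<^sup>+z. (\<integral>\<^sup>+w. ?F w y z \<partial>lborel) \<partial>lborel) \<partial>lborel)"
    by (intro nn_integral_cong lborel_pair.Fubini') measurable
  also have "\<dots> \<le> (\<integral>\<^sup>+y. (\<integral>\<^sup>+z. ennreal (v * (2 * d) ^ n) * ennreal (gag_kernel p u y z) \<partial>lborel) \<partial>lborel)"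
    by (intro nn_integral_mono vol)
  also have "\<dots> = ennreal (v * (2 * d) ^ n) * energy p u"
    by (simp add: nn_integral_cmult energy_def)
  finally have main: "ennreal (v * (d * r ^ (n - 1))) * local_energy p u x d \<le> ennreal (v * (2 * d) ^ n) * energy p u" .
  define c where "c = v * (d * r ^ (n - 1))"
  have c: "c > 0" using v r assms by (simp add: c_def)
  have n: "n = Suc (n - 1)" using DIM_positive[where 'a='a] by (simp add: n_def)
  have "inverse c * (v * (2 * d) ^ n) = 2 ^ n * (d / r) ^ (n - 1)"
    using v r assms by (subst n, subst (2) n) (simp add: c_def field_simps power_mult_distrib power_divide)
  have "local_energy p u x d = ennreal (inverse c) * (ennreal c * local_energy p u x d)"
    using c by (simp add: mult.assoc[symmetric] ennreal_mult[symmetric])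
  also have "\<dots> \<le> ennreal (inverse c) * (ennreal (v * (2 * d) ^ n) * energy p u)"
    unfolding c_def by (intro mult_left_mono main) auto
  also have "\<dots> = ennreal (inverse c * (v * (2 * d) ^ n)) * energy p u"
    using c v assms by (simp add: mult.assoc ennreal_mult)
  also have "inverse c * (v * (2 * d) ^ n) = 2 ^ n * (d / r) ^ (n - 1)" by fact
  finally show ?thesis by (simp add: n_def r_def)
qed

section \<open>Ball means\<close>

definition ball_mean :: "('a::euclidean_space \<Rightarrow> real) \<Rightarrow> 'a \<Rightarrow> real \<Rightarrow> real" where
  "ball_mean u x d = (LINT y:ball x d|lborel. u y) / measure lborel (ball x d)"

lemma content_ball_eq_powr:
  assumes "d > 0"
  shows "measure lborel (ball (x::'a::euclidean_space) d) = unit_ball_vol DIM('a) * d powr DIM('a)"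
  using assms by (simp add: content_ball powr_realpow)

lemma emeasure_ball_eq_content: "emeasure lborel (ball (x::'a::euclidean_space) d) = ennreal (measure lborel (ball x d))"
  using emeasure_lborel_ball_finite[of x d] by (simp add: emeasure_eq_ennreal_measure less_top)

lemma integrable_indicator_ball: "integrable lborel (indicator (ball (x::'a::euclidean_space) d) :: 'a \<Rightarrow> real)"
  using emeasure_lborel_ball_finite[of x d] by (intro integrable_real_indicator) auto

lemma ball_borel [measurable]: "ball (x::'a::metric_space) d \<in> sets borel"
  by simp

text \<open>Jensen's inequality for the square. With \<open>m\<close> the mean, the tangent bound at
  \<open>u y = m\<close> is integrated, and its linear term \<open>u y - m\<close> has integral 0.
  An infinite right side is the trivial case.\<close>

lemma ball_mean_variance:
  fixes u :: "'a::euclidean_space \<Rightarrow> real"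
  assumes u: "set_integrable lborel (ball x d) u" and [measurable]: "u \<in> borel_measurable borel"
    and d: "d > 0"
  shows "ennreal (measure lborel (ball x d) * (ball_mean u x d - c)\<^sup>2)
     \<le> (\<integral>\<^sup>+y. indicator (ball x d) y * ennreal ((u y - c)\<^sup>2) \<partial>lborel)"
proof (cases "(\<integral>\<^sup>+y. indicator (ball x d) y * ennreal ((u y - c)\<^sup>2) \<partial>lborel) = \<infinity>")
  case False
  define B where "B = ball x d"
  have [measurable]: "B \<in> sets borel" by (simp add: B_def)
  define m where "m = ball_mean u x d"
  define v where "v = measure lborel (ball x d)"
  have v: "v > 0" using content_ball_pos[OF d] by (simp add: v_def)
  have iu: "integrable lborel (\<lambda>y. indicator B y * u y)"
    using u by (simp add: set_integrable_def B_def)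
  have i1: "integrable lborel (indicator B :: 'a \<Rightarrow> real)"
    unfolding B_def by (rule integrable_indicator_ball)
  have e: "ennreal (indicator B y * (u y - c)\<^sup>2) = indicator B y * ennreal ((u y - c)\<^sup>2)" for y
    by (simp add: indicator_def)
  have ic: "integrable lborel (\<lambda>y. indicator B y * (u y - c)\<^sup>2)"
    using False unfolding B_def[symmetric] by (intro integrableI_nonneg) (auto simp: e less_top)
  have mu: "(\<integral>y. indicator B y * u y \<partial>lborel) = m * v"
    using v by (simp add: m_def ball_mean_def v_def set_lebesgue_integral_def B_def)
  have vi: "(\<integral>y. indicator B y \<partial>lborel) = v"
    by (simp add: v_def B_def)
  have eq: "(\<lambda>y. indicator B y * ((m - c)\<^sup>2 + 2 * (m - c) * (u y - m)))
    = (\<lambda>y. ((m - c)\<^sup>2 - 2 * (m - c) * m) * indicator B y + 2 * (m - c) * (indicator B y * u y))"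
    by (auto simp: algebra_simps)
  have "v * (m - c)\<^sup>2 = (\<integral>y. indicator B y * ((m - c)\<^sup>2 + 2 * (m - c) * (u y - m)) \<partial>lborel)"
  proof -
    have "(\<integral>y. indicator B y * ((m - c)\<^sup>2 + 2 * (m - c) * (u y - m)) \<partial>lborel)
        = ((m - c)\<^sup>2 - 2 * (m - c) * m) * v + 2 * (m - c) * (m * v)"
      unfolding eq by (subst Bochner_Integration.integral_add) (use i1 iu mu vi in auto)
    then show ?thesis by (simp add: algebra_simps)
  qed
  also have "\<dots> \<le> (\<integral>y. indicator B y * (u y - c)\<^sup>2 \<partial>lborel)"
  proof (rule integral_mono)
    show "integrable lborel (\<lambda>y. indicator B y * ((m - c)\<^sup>2 + 2 * (m - c) * (u y - m)))"
      unfolding eq using i1 iu by auto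
    show "indicator B y * ((m - c)\<^sup>2 + 2 * (m - c) * (u y - m)) \<le> indicator B y * (u y - c)\<^sup>2" for y
    proof -
      have "0 \<le> (u y - m)\<^sup>2" by simp
      also have "\<dots> = (u y - c)\<^sup>2 - ((m - c)\<^sup>2 + 2 * (m - c) * (u y - m))"
        by (simp add: power2_eq_square algebra_simps)
      finally show ?thesis by (intro mult_left_mono) auto
    qed
  qed (rule ic)
  finally have "ennreal (v * (m - c)\<^sup>2) \<le> ennreal (\<integral>y. indicator B y * (u y - c)\<^sup>2 \<partial>lborel)"
    by (rule ennreal_leI)
  also have "\<dots> = (\<integral>\<^sup>+y. ennreal (indicator B y * (u y - c)\<^sup>2) \<partial>lborel)"
    by (rule nn_integral_eq_integral[OF ic, symmetric]) auto
  finally show ?thesis by (simp add: m_def v_def e flip: B_def)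
qed auto

text \<open>Converts squared differences at bounded distance into Gagliardo energy. For
  \<open>y = z\<close> the quotient cannot be cleared, but both sides are then 0.\<close>

lemma square_diff_le_gag_kernel:
  assumes "norm (y - z) \<le> d" "p \<ge> 0"
  shows "(u y - u z)\<^sup>2 \<le> d powr p * gag_kernel p u y z"
proof (cases "y = z")
  case False
  then have "norm (y - z) powr p > 0" by simp
  then have "(u y - u z)\<^sup>2 = norm (y - z) powr p * gag_kernel p u y z"
    by (simp add: gag_kernel_def)
  also have "\<dots> \<le> d powr p * gag_kernel p u y z"
    using assms by (intro mult_right_mono powr_mono2) auto
  finally show ?thesis .
qed simp

text \<open>Both means are compared with u(z), and the inequality is then integrated over z in the
  smaller ball.\<close>

lemma ball_mean_step:
  fixes u :: "'a::euclidean_space \<Rightarrow> real"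
  assumes u: "\<And>e. set_integrable lborel (ball x e) u" and [measurable]: "u \<in> borel_measurable borel"
    and d: "d > 0" and p: "p \<ge> 0"
  shows "ennreal ((ball_mean u x d - ball_mean u x (2 * d))\<^sup>2)
    \<le> ennreal (4 * 4 powr p / (unit_ball_vol DIM('a))\<^sup>2 * d powr (p - 2 * DIM('a))) * local_energy p u x (2 * d)"
proof -
  define v where "v = measure lborel (ball x d)"
  have v: "v > 0" using content_ball_pos[OF d] by (simp add: v_def)
  define a b where "a = ball_mean u x d" and "b = ball_mean u x (2 * d)"
  define I where "I z = (\<integral>\<^sup>+y. indicator (ball x (2 * d)) y * ennreal ((u y - u z)\<^sup>2) \<partial>lborel)" for z
  have sub: "ball x d \<subseteq> ball x (2 * d)" using d by (simp add: subset_ball)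
  have vle: "v \<le> measure lborel (ball x (2 * d))"
    unfolding v_def using sub emeasure_lborel_ball_finite[of x "2*d"]
    by (intro measure_mono_fmeasurable) (auto simp: fmeasurable_def)
  \<comment> \<open>\<open>I z\<close> integrates over the larger ball, so it dominates both
    variances; for the larger mean, the volume of its ball is bounded below by
    \<open>v\<close>.\<close>
  have I: "ennreal (v * (a - b)\<^sup>2) \<le> 4 * I z" for z
  proof -
    have 1: "ennreal (v * (a - u z)\<^sup>2) \<le> I z"
    proof -
      have "ennreal (v * (a - u z)\<^sup>2) \<le> (\<integral>\<^sup>+y. indicator (ball x d) y * ennreal ((u y - u z)\<^sup>2) \<partial>lborel)"
        unfolding v_def a_def by (intro ball_mean_variance u d) measurable
      also have "\<dots> \<le> I z"
        unfolding I_def using sub by (intro nn_integral_mono) (auto simp: indicator_def)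
      finally show ?thesis .
    qed
    have "ennreal (v * (b - u z)\<^sup>2) \<le> ennreal (measure lborel (ball x (2 * d)) * (b - u z)\<^sup>2)"
      using vle by (intro ennreal_leI mult_right_mono) auto
    also have "\<dots> \<le> I z"
      unfolding I_def b_def using d by (intro ball_mean_variance u) auto
    finally have 2: "ennreal (v * (b - u z)\<^sup>2) \<le> I z" .
    \<comment> \<open>The parallelogram identity with the square of the sum dropped.\<close>
    have "(a - b)\<^sup>2 \<le> 2 * (a - u z)\<^sup>2 + 2 * (b - u z)\<^sup>2"
    proof -
      have "0 \<le> ((a - u z) + (b - u z))\<^sup>2" by simp
      also have "\<dots> = 2 * (a - u z)\<^sup>2 + 2 * (b - u z)\<^sup>2 - (a - b)\<^sup>2"
        by (simp add: power2_eq_square algebra_simps)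
      finally show ?thesis by simp
    qed
    then have "v * (a - b)\<^sup>2 \<le> v * (2 * (a - u z)\<^sup>2 + 2 * (b - u z)\<^sup>2)"
      using v by (intro mult_left_mono) auto
    also have "\<dots> = 2 * (v * (a - u z)\<^sup>2) + 2 * (v * (b - u z)\<^sup>2)"
      by (simp add: algebra_simps)
    finally have "ennreal (v * (a - b)\<^sup>2) \<le> ennreal (2 * (v * (a - u z)\<^sup>2) + 2 * (v * (b - u z)\<^sup>2))"
      by (rule ennreal_leI)
    also have "\<dots> = 2 * ennreal (v * (a - u z)\<^sup>2) + 2 * ennreal (v * (b - u z)\<^sup>2)"
      using v by (simp add: ennreal_plus ennreal_mult')
    also have "\<dots> \<le> 2 * I z + 2 * I z"
      using 1 2 by (intro add_mono mult_left_mono) auto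
    also have "\<dots> = (2 + 2) * I z" by (simp only: distrib_right)
    finally show ?thesis by simp
  qed
  \<comment> \<open>Integration over \<open>z\<close> in the smaller ball produces a second factor
    \<open>v\<close>, hence the division by \<open>v * v\<close> at the end.\<close>
  have "ennreal (v * v * (a - b)\<^sup>2) = (\<integral>\<^sup>+z. indicator (ball x d) z * ennreal (v * (a - b)\<^sup>2) \<partial>lborel)"
    using v by (subst nn_integral_multc)
      (auto intro!: borel_measurable_indicator simp: emeasure_ball_eq_content v_def ennreal_mult'' mult.assoc)
  also have "\<dots> \<le> (\<integral>\<^sup>+z. indicator (ball x d) z * (4 * I z) \<partial>lborel)"
    using I by (intro nn_integral_mono mult_left_mono) auto
  also have "\<dots> = (\<integral>\<^sup>+z. (\<integral>\<^sup>+y. 4 * (indicator (ball x d) z * (indicator (ball x (2 * d)) y * ennreal ((u y - u z)\<^sup>2))) \<partial>lborel) \<partial>lborel)"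
    unfolding I_def by (simp add: nn_integral_cmult mult.left_commute)
  also have "\<dots> \<le> (\<integral>\<^sup>+z. (\<integral>\<^sup>+y. ennreal (4 * (4 * d) powr p) * (indicator {..<2*d} (dist x z) * indicator {..<2*d} (dist x y)
     * ennreal (gag_kernel p u z y)) \<partial>lborel) \<partial>lborel)"
  proof (intro nn_integral_mono)
    fix z y :: 'a
    show "4 * (indicator (ball x d) z * (indicator (ball x (2 * d)) y * ennreal ((u y - u z)\<^sup>2)))
       \<le> ennreal (4 * (4 * d) powr p) * (indicator {..<2*d} (dist x z) * indicator {..<2*d} (dist x y) * ennreal (gag_kernel p u z y))"
    proof (cases "z \<in> ball x d \<and> y \<in> ball x (2 * d)")
      case True
      then have zy: "dist x z < 2 * d" "dist x y < 2 * d" using d by auto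
      \<comment> \<open>Two points of the ball of radius \<open>2 * d\<close> are at most
        \<open>4 * d\<close> apart, which is where \<open>4 powr p\<close> comes from.\<close>
      then have "norm (z - y) \<le> 4 * d"
        using dist_triangle[of z y x] by (simp add: dist_norm norm_minus_commute)
      then have "(u z - u y)\<^sup>2 \<le> (4 * d) powr p * gag_kernel p u z y"
        by (rule square_diff_le_gag_kernel) fact
      then have "ennreal (4 * (u y - u z)\<^sup>2) \<le> ennreal (4 * ((4 * d) powr p * gag_kernel p u z y))"
        by (intro ennreal_leI) (simp add: power2_commute)
      also have "\<dots> = ennreal (4 * (4 * d) powr p) * ennreal (gag_kernel p u z y)"
        by (simp add: ennreal_mult mult.assoc)
      finally show ?thesis using zy True by (simp add: ennreal_mult)
    qed (auto simp: indicator_def)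
  qed
  also have "\<dots> = ennreal (4 * (4 * d) powr p) * local_energy p u x (2 * d)"
    unfolding local_energy_def by (simp add: nn_integral_cmult)
  finally have main: "ennreal (v * v * (a - b)\<^sup>2) \<le> ennreal (4 * (4 * d) powr p) * local_energy p u x (2 * d)" .
  have "ennreal ((a - b)\<^sup>2) = ennreal (inverse (v * v)) * ennreal (v * v * (a - b)\<^sup>2)"
    using v by (subst ennreal_mult[symmetric]) (auto simp: field_simps simp del: mult_eq_0_iff)
  also have "\<dots> \<le> ennreal (inverse (v * v)) * (ennreal (4 * (4 * d) powr p) * local_energy p u x (2 * d))"
    by (intro mult_left_mono main) auto
  also have "\<dots> = ennreal (inverse (v * v) * (4 * (4 * d) powr p)) * local_energy p u x (2 * d)"
    using v by (simp add: ennreal_mult mult.assoc)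
  also have "inverse (v * v) * (4 * (4 * d) powr p)
     = 4 * 4 powr p / (unit_ball_vol DIM('a))\<^sup>2 * d powr (p - 2 * DIM('a))"
    using d by (simp add: v_def content_ball_eq_powr powr_mult powr_diff powr_add[symmetric] divide_simps power2_eq_square)
  finally show ?thesis by (simp add: a_def b_def)
qed

section \<open>Limits of ball means at small and large radii\<close>

text \<open>A quantitative form of Lebesgue differentiation at one given point:
  \<open>ball_mean_variance\<close> with \<open>c = u x\<close> bounds the squared error by a
  multiple of \<open>d powr (p - N)\<close>, and this exponent is positive.\<close>

lemma ball_mean_tendsto_point:
  fixes u :: "'a::euclidean_space \<Rightarrow> real"
  assumes u: "\<And>e. set_integrable lborel (ball x e) u" and [measurable]: "u \<in> borel_measurable borel"
    and p: "p > real DIM('a)" and fin: "(\<integral>\<^sup>+y. ennreal (gag_kernel p u x y) \<partial>lborel) < \<infinity>"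
  shows "(ball_mean u x \<longlongrightarrow> u x) (at_right 0)"
proof -
  obtain G where G: "(\<integral>\<^sup>+y. ennreal (gag_kernel p u x y) \<partial>lborel) = ennreal G" "G \<ge> 0"
    using fin by (cases "\<integral>\<^sup>+y. ennreal (gag_kernel p u x y) \<partial>lborel" rule: ennreal_cases) auto
  define V where "V = unit_ball_vol DIM('a)"
  have V: "V > 0" by (simp add: V_def)
  have le: "(ball_mean u x d - u x)\<^sup>2 \<le> G / V * d powr (p - DIM('a))" if d: "d > 0" for d
  proof -
    have "ennreal (measure lborel (ball x d) * (ball_mean u x d - u x)\<^sup>2)
      \<le> (\<integral>\<^sup>+y. indicator (ball x d) y * ennreal ((u y - u x)\<^sup>2) \<partial>lborel)"
      by (intro ball_mean_variance u d) measurable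
    also have "\<dots> \<le> (\<integral>\<^sup>+y. ennreal (d powr p) * ennreal (gag_kernel p u x y) \<partial>lborel)"
    proof (intro nn_integral_mono)
      fix y
      show "indicator (ball x d) y * ennreal ((u y - u x)\<^sup>2) \<le> ennreal (d powr p) * ennreal (gag_kernel p u x y)"
      proof (cases "y \<in> ball x d")
        case True
        then have "(u x - u y)\<^sup>2 \<le> d powr p * gag_kernel p u x y"
          using p by (intro square_diff_le_gag_kernel) (auto simp: dist_norm)
        then have "ennreal ((u y - u x)\<^sup>2) \<le> ennreal (d powr p * gag_kernel p u x y)"
          by (intro ennreal_leI) (simp add: power2_commute)
        then show ?thesis using True by (simp add: ennreal_mult)
      qed auto
    qed
    also have "\<dots> = ennreal (d powr p * G)"
      using G by (simp add: nn_integral_cmult ennreal_mult)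
    finally have "measure lborel (ball x d) * (ball_mean u x d - u x)\<^sup>2 \<le> d powr p * G"
      using G by (subst (asm) ennreal_le_iff) auto
    then show ?thesis
      using d V by (simp add: content_ball_eq_powr powr_diff field_simps V_def)
  qed
  have "((\<lambda>d. G / V * d powr (p - DIM('a))) \<longlongrightarrow> G / V * 0) (at_right 0)"
    using p by (intro tendsto_mult tendsto_const tendsto_zero_powrI[where b = "p - DIM('a)"])
      (auto simp: eventually_at_right_field intro!: exI[of _ 1])
  then have lim: "((\<lambda>d. G / V * d powr (p - DIM('a))) \<longlongrightarrow> 0) (at_right 0)" by simp
  have "((\<lambda>d. (ball_mean u x d - u x)\<^sup>2) \<longlongrightarrow> 0) (at_right 0)"
    by (rule tendsto_sandwich[OF _ _ tendsto_const lim])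
       (auto simp: eventually_at_right_field simp del: times_divide_eq_left intro!: exI[of _ 1] le)
  then have "((\<lambda>d. sqrt ((ball_mean u x d - u x)\<^sup>2)) \<longlongrightarrow> sqrt 0) (at_right 0)"
    by (rule tendsto_real_sqrt)
  then have "((\<lambda>d. ball_mean u x d - u x) \<longlongrightarrow> 0) (at_right 0)"
    by (simp add: tendsto_rabs_zero_iff)
  then show ?thesis by (simp add: LIM_zero_iff)
qed

text \<open>If \<open>\<bar>t\<bar> > \<epsilon>\<close>, the factor
  \<open>(\<bar>t\<bar> / \<epsilon>) powr (q - 1)\<close> is at least 1. This stands in for
  Hoelder's inequality on balls and includes \<open>q = 1\<close>.\<close>

lemma abs_le_eps_plus_powr:
  fixes t \<epsilon> q :: real
  assumes "\<epsilon> > 0" "q \<ge> 1"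
  shows "\<bar>t\<bar> \<le> \<epsilon> + \<epsilon> powr (1 - q) * \<bar>t\<bar> powr q"
proof (cases "\<bar>t\<bar> \<le> \<epsilon>")
  case False
  have "\<bar>t\<bar> = \<bar>t\<bar> powr (1 - q) * \<bar>t\<bar> powr q"
    using False assms by (simp flip: powr_add)
  also have "\<dots> \<le> \<epsilon> powr (1 - q) * \<bar>t\<bar> powr q"
    using False assms by (intro mult_right_mono powr_mono2') auto
  finally show ?thesis using assms by simp
qed (simp add: add_increasing2)

lemma powr_integrable_imp_ball_integrable:
  fixes u :: "'a::euclidean_space \<Rightarrow> real"
  assumes [measurable]: "u \<in> borel_measurable borel" and q: "q \<ge> 1"
    and I: "integrable lborel (\<lambda>x. \<bar>u x\<bar> powr q)"
  shows "set_integrable lborel (ball x d) u"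
  unfolding set_integrable_def
proof (rule Bochner_Integration.integrable_bound)
  show "integrable lborel (\<lambda>y. indicator (ball x d) y + \<bar>u y\<bar> powr q)"
    using I integrable_indicator_ball[of x d] by (intro Bochner_Integration.integrable_add)
  show "AE y in lborel. norm (indicator (ball x d) y *\<^sub>R u y) \<le> norm (indicator (ball x d) y + \<bar>u y\<bar> powr q)"
    using abs_le_eps_plus_powr[OF zero_less_one q] by (auto simp: indicator_def)
qed measurable

lemma ball_mean_tendsto_0:
  fixes u :: "'a::euclidean_space \<Rightarrow> real"
  assumes [measurable]: "u \<in> borel_measurable borel" and q: "q \<ge> 1"
    and I: "integrable lborel (\<lambda>x. \<bar>u x\<bar> powr q)"
  shows "(ball_mean u x \<longlongrightarrow> 0) at_top"
proof -
  define P where "P = (\<integral>y. \<bar>u y\<bar> powr q \<partial>lborel)"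
  have P: "P \<ge> 0" by (simp add: P_def)
  \<comment> \<open>Here \<open>\<epsilon>\<close> stays free: it is fixed first, and a large
    \<open>d\<close> then makes the second term small.\<close>
  have bound: "\<bar>ball_mean u x d\<bar> \<le> \<epsilon> + \<epsilon> powr (1 - q) * P / measure lborel (ball x d)" if "d > 0" "\<epsilon> > 0" for d \<epsilon>
  proof -
    have c: "measure lborel (ball x d) > 0" using content_ball_pos[OF \<open>d > 0\<close>] .
    have "\<bar>LINT y:ball x d|lborel. u y\<bar> \<le> (\<integral>y. \<epsilon> * indicator (ball x d) y + \<epsilon> powr (1 - q) * \<bar>u y\<bar> powr q \<partial>lborel)"
      unfolding set_lebesgue_integral_def real_norm_def[symmetric]
    proof (rule Bochner_Integration.integral_norm_bound_integral)
      show "integrable lborel (\<lambda>y. indicator (ball x d) y *\<^sub>R u y)"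
        using powr_integrable_imp_ball_integrable[OF assms] by (simp add: set_integrable_def)
      show "integrable lborel (\<lambda>y. \<epsilon> * indicator (ball x d) y + \<epsilon> powr (1 - q) * norm (u y) powr q)"
        using I integrable_indicator_ball[of x d] by auto
      show "norm (indicator (ball x d) y *\<^sub>R u y) \<le> \<epsilon> * indicator (ball x d) y + \<epsilon> powr (1 - q) * norm (u y) powr q" for y
        using abs_le_eps_plus_powr[OF \<open>\<epsilon> > 0\<close> q, of "u y"] by (auto simp: indicator_def)
    qed
    also have "\<dots> = \<epsilon> * measure lborel (ball x d) + \<epsilon> powr (1 - q) * P"
      using I integrable_indicator_ball[of x d] by (simp add: P_def)
    finally show ?thesis
      using c by (simp add: ball_mean_def field_simps)
  qed
  have lim0: "((\<lambda>d. 1 / measure lborel (ball x d)) \<longlongrightarrow> 0) at_top"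
  proof -
    have "((\<lambda>d. inverse (unit_ball_vol DIM('a)) * inverse d ^ DIM('a)) \<longlongrightarrow> inverse (unit_ball_vol DIM('a)) * 0 ^ DIM('a)) at_top"
      by (intro tendsto_mult tendsto_const tendsto_power tendsto_inverse_0_at_top filterlim_ident)
    moreover have "(0::real) ^ DIM('a) = 0" by (simp add: power_0_left)
    ultimately have "((\<lambda>d. inverse (unit_ball_vol DIM('a)) * inverse d ^ DIM('a)) \<longlongrightarrow> 0) at_top"
      by simp
    moreover have "\<forall>\<^sub>F d in at_top. 1 / measure lborel (ball x d) = inverse (unit_ball_vol DIM('a)) * inverse d ^ DIM('a)"
      using eventually_ge_at_top[of 0] by eventually_elim (simp add: content_ball field_simps)
    ultimately show ?thesis by (simp cong: filterlim_cong)
  qed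
  show ?thesis
  proof (rule tendstoI)
    fix e :: real assume e: "e > 0"
    have "((\<lambda>d. e / 2 + (e / 2) powr (1 - q) * P * (1 / measure lborel (ball x d))) \<longlongrightarrow> e / 2 + (e / 2) powr (1 - q) * P * 0) at_top"
      by (intro tendsto_add tendsto_mult tendsto_const lim0)
    from order_tendstoD(2)[OF this, of e] have "\<forall>\<^sub>F d in at_top. e / 2 + (e / 2) powr (1 - q) * P * (1 / measure lborel (ball x d)) < e"
      using e by simp
    then show "\<forall>\<^sub>F d in at_top. dist (ball_mean u x d) 0 < e"
      using eventually_gt_at_top[of 0]
    proof eventually_elim
      case (elim d)
      then show ?case using bound[of d "e/2"] e by simp
    qed
  qed
qed

section \<open>The radial estimate\<close>

text \<open>Telescoping bounds the distance from \<open>a 0\<close> to every \<open>a n\<close> by a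
  partial geometric sum, uniformly in \<open>n\<close>, and the bound survives the limit.\<close>

lemma geometric_increments_limit:
  fixes a :: "nat \<Rightarrow> real"
  assumes lim: "a \<longlonglongrightarrow> L" and inc: "\<And>k. \<bar>a (Suc k) - a k\<bar> \<le> A * \<theta> ^ k"
    and \<theta>: "0 \<le> \<theta>" "\<theta> < 1"
  shows "\<bar>a 0 - L\<bar> \<le> A / (1 - \<theta>)"
proof -
  have A: "A \<ge> 0" using inc[of 0] abs_ge_zero[of "a (Suc 0) - a 0"] by simp
  have "\<bar>a 0 - a n\<bar> \<le> A / (1 - \<theta>)" for n
  proof -
    have "\<bar>a 0 - a n\<bar> = \<bar>\<Sum>k<n. a (Suc k) - a k\<bar>"
      by (simp add: sum_lessThan_telescope abs_minus_commute)
    also have "\<dots> \<le> (\<Sum>k<n. A * \<theta> ^ k)"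
      using inc by (intro order_trans[OF sum_abs] sum_mono)
    also have "\<dots> = A * ((1 - \<theta> ^ n) / (1 - \<theta>))"
      using \<theta> by (simp add: sum_distrib_left[symmetric] sum_gp_strict)
    also have "\<dots> \<le> A * (1 / (1 - \<theta>))"
      using \<theta> A by (intro mult_left_mono divide_right_mono) auto
    finally show ?thesis by simp
  qed
  then show ?thesis
    by (intro tendsto_upperbound[OF tendsto_rabs[OF tendsto_diff[OF tendsto_const lim]]]) auto
qed

lemma power_powr_double: "b > 0 \<Longrightarrow> (b ^ k) powr (2 * e) = ((b powr e) ^ k)\<^sup>2" for b e :: real
  by (simp add: powr_powr powr_power mult_ac flip: powr_realpow)

text \<open>The square root is the constant of one dyadic step. The first summand sums the geometric
  series over radii at least \<open>norm x\<close>, the second the one over smaller radii, where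
  \<open>2 ^ DIM('a)\<close> absorbs the constants of the annulus averaging.\<close>

definition radial_const :: "'a::euclidean_space itself \<Rightarrow> real \<Rightarrow> real" where
  "radial_const _ s = sqrt (4 * 4 powr (real DIM('a) + 2 * s) / (unit_ball_vol DIM('a))\<^sup>2)
     * (1 / (1 - 2 powr (- ((real DIM('a) - 2 * s) / 2))) + 2 ^ DIM('a) / (1 - 2 powr (- (s - 1/2))))"

lemma radial_pointwise_bound:
  fixes u :: "'a::euclidean_space \<Rightarrow> real"
  assumes [measurable]: "u \<in> borel_measurable borel" and u: "radial u" and q: "q \<ge> 1"
    and I: "integrable lborel (\<lambda>x. \<bar>u x\<bar> powr q)"
    and s: "1/2 < s" "2 * s < real DIM('a)"
    and D: "energy (real DIM('a) + 2 * s) u \<le> ennreal D" "D \<ge> 0"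
    and x: "x \<noteq> 0" and fin: "(\<integral>\<^sup>+y. ennreal (gag_kernel (real DIM('a) + 2 * s) u x y) \<partial>lborel) < \<infinity>"
  shows "\<bar>u x\<bar> \<le> radial_const TYPE('a) s * sqrt D * norm x powr (- ((real DIM('a) - 2 * s) / 2))"
proof -
  define n where "n = DIM('a)"
  define p where "p = real n + 2 * s"
  define \<nu> where "\<nu> = (n - 2 * s) / 2"
  define C0 where "C0 = 4 * 4 powr p / (unit_ball_vol n)\<^sup>2"
  define r where "r = norm x"
  define \<theta>1 \<theta>2 where "\<theta>1 = (2::real) powr (- \<nu>)" and "\<theta>2 = (2::real) powr (- (s - 1/2))"
  define m where "m = ball_mean u x"
  \<comment> \<open>The bound for one dyadic increment at radius \<open>r\<close> when the whole
    energy is charged.\<close>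
  define B where "B = sqrt (C0 * D) * r powr (- \<nu>)"
  have r: "r > 0" using x by (simp add: r_def)
  have C0: "C0 \<ge> 0" by (simp add: C0_def)
  have B: "B \<ge> 0" "B\<^sup>2 = C0 * D * r powr (2 * s - n)"
  proof -
    have "(r powr (- \<nu>))\<^sup>2 = r powr (2 * s - n)"
      by (simp add: power2_eq_square \<nu>_def flip: powr_add)
    then show "B\<^sup>2 = C0 * D * r powr (2 * s - n)"
      using C0 D by (simp add: B_def power_mult_distrib)
  qed (use C0 D in \<open>simp add: B_def\<close>)
  have \<theta>: "0 \<le> \<theta>1" "\<theta>1 < 1" "0 \<le> \<theta>2" "\<theta>2 < 1"
    using s by (auto simp: \<theta>1_def \<theta>2_def \<nu>_def n_def powr_less_one)
  have loc: "set_integrable lborel (ball x e) u" for e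
    by (rule powr_integrable_imp_ball_integrable[OF assms(1) q I])
  \<comment> \<open>The factor \<open>c\<close> is the share of the total energy seen at this scale:
    1 for large radii, a power of \<open>d / r\<close> times a constant for small ones.\<close>
  have step: "(m d - m (2 * d))\<^sup>2 \<le> C0 * d powr (2 * s - n) * (c * D)"
    if d: "d > 0" and c: "local_energy p u x (2 * d) \<le> ennreal c * energy p u" "c \<ge> 0" for d c
  proof -
    have "ennreal ((m d - m (2 * d))\<^sup>2) \<le> ennreal (C0 * d powr (p - 2 * n)) * local_energy p u x (2 * d)"
      unfolding m_def C0_def n_def using s d by (intro ball_mean_step loc) (auto simp: p_def)
    also have "\<dots> \<le> ennreal (C0 * d powr (p - 2 * n)) * (ennreal c * ennreal D)"
      using D(1) c unfolding p_def n_def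
      by (intro mult_left_mono order_trans[OF c(1)[unfolded p_def n_def]]) auto
    also have "\<dots> = ennreal (C0 * d powr (p - 2 * n) * (c * D))"
      using C0 c D(2) by (simp add: ennreal_mult)
    finally have "(m d - m (2 * d))\<^sup>2 \<le> C0 * d powr (p - 2 * n) * (c * D)"
      using C0 c D(2) by (subst (asm) ennreal_le_iff) auto
    moreover have "p - 2 * n = 2 * s - n" by (simp add: p_def)
    ultimately show ?thesis by simp
  qed
  have far: "\<bar>m (r * 2 ^ Suc k) - m (r * 2 ^ k)\<bar> \<le> B * \<theta>1 ^ k" for k
  proof -
    have "(m (r * 2 ^ k) - m (2 * (r * 2 ^ k)))\<^sup>2 \<le> C0 * (r * 2 ^ k) powr (2 * s - n) * (1 * D)"
      using r by (intro step) (auto simp: local_energy_le)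
    also have "\<dots> = B\<^sup>2 * (2 ^ k) powr (2 * s - n)"
      using r B by (simp add: powr_mult)
    also have "2 * s - n = 2 * (- \<nu>)" by (simp add: \<nu>_def field_simps)
    also have "(2 ^ k) powr (2 * (- \<nu>)) = (\<theta>1 ^ k)\<^sup>2"
      unfolding \<theta>1_def by (rule power_powr_double) simp
    finally have "\<bar>m (r * 2 ^ Suc k) - m (r * 2 ^ k)\<bar>\<^sup>2 \<le> (B * \<theta>1 ^ k)\<^sup>2"
      by (simp add: power_mult_distrib power2_commute[of "m (r * 2 ^ k)"] mult.left_commute)
    then show ?thesis
      by (rule power2_le_imp_le) (use B(1) \<theta> in simp)
  qed
  \<comment> \<open>Now \<open>d = r * t\<close> with \<open>2 * d = r / 2 ^ k\<close>. The gain
    \<open>t ^ (n - 1)\<close> from symmetry turns the growing factor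
    \<open>t powr (2 * s - n)\<close> into \<open>t powr (2 * s - 1)\<close>, which decays because
    \<open>s > 1/2\<close>.\<close>
  have near: "\<bar>m (r / 2 ^ Suc k) - m (r / 2 ^ k)\<bar> \<le> (B * 2 ^ n) * \<theta>2 ^ k" for k
  proof -
    define t where "t = 1 / (2::real) ^ Suc k"
    have t: "t > 0" by (simp add: t_def)
    have tn: "t ^ (n - 1) = t powr (real n - 1)"
      using t DIM_positive[where 'a='a] by (simp add: n_def Suc_leI of_nat_diff flip: powr_realpow)
    have "local_energy p u x (2 * (r * t)) \<le> ennreal (2 ^ n * (2 * (r * t) / r) ^ (n - 1)) * energy p u"
      unfolding n_def r_def by (rule local_energy_radial_le[OF assms(1) u x]) (use r t in \<open>simp add: r_def\<close>)
    from step[OF _ this]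
    have "(m (r * t) - m (2 * (r * t)))\<^sup>2 \<le> C0 * (r * t) powr (2 * s - n) * (2 ^ n * (2 * (r * t) / r) ^ (n - 1) * D)"
      using r t by simp
    also have "\<dots> = B\<^sup>2 * (2 ^ n * 2 ^ (n - 1)) * (t powr (2 * s - n) * t ^ (n - 1))"
      using r B by (simp add: powr_mult power_mult_distrib)
    also have "t powr (2 * s - n) * t ^ (n - 1) = t powr (2 * s - 1)"
      unfolding tn by (simp flip: powr_add)
    \<comment> \<open>Constants are enlarged to make the bound a perfect square, and
      \<open>t\<close> is replaced by the larger \<open>1 / 2 ^ k\<close> so that the ratio appears
      with exponent \<open>k\<close>.\<close>
    also have "B\<^sup>2 * (2 ^ n * 2 ^ (n - 1)) * t powr (2 * s - 1) \<le> B\<^sup>2 * (2 ^ n * 2 ^ n) * (1 / 2 ^ k) powr (2 * s - 1)"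
    proof (intro mult_mono)
      show "t powr (2 * s - 1) \<le> (1 / 2 ^ k) powr (2 * s - 1)"
        using s t by (intro powr_mono2) (auto simp: t_def field_simps)
      show "(2::real) ^ (n - 1) \<le> 2 ^ n"
        by (rule power_increasing) auto
    qed auto
    also have "(1 / 2 ^ k) powr (2 * s - 1) = ((1 / 2) ^ k) powr (2 * (s - 1 / 2))"
      by (simp add: power_one_over)
    also have "\<dots> = (\<theta>2 ^ k)\<^sup>2"
      unfolding \<theta>2_def powr_minus_divide by (subst power_powr_double) (simp_all add: powr_divide)
    also have "B\<^sup>2 * (2 ^ n * 2 ^ n) * (\<theta>2 ^ k)\<^sup>2 = ((B * 2 ^ n) * \<theta>2 ^ k)\<^sup>2"
      by (simp add: power_mult_distrib power2_eq_square)
    finally have "\<bar>m (r / 2 ^ Suc k) - m (r / 2 ^ k)\<bar>\<^sup>2 \<le> ((B * 2 ^ n) * \<theta>2 ^ k)\<^sup>2"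
      by (simp add: t_def)
    then show ?thesis
      by (rule power2_le_imp_le) (use B(1) \<theta> in simp)
  qed
  have "filterlim (\<lambda>k. r * 2 ^ k) at_top sequentially"
    using r by (intro filterlim_tendsto_pos_mult_at_top[OF tendsto_const]
        filterlim_at_infinity_imp_filterlim_at_top filterlim_realpow_sequentially_gt1) auto
  with ball_mean_tendsto_0[OF assms(1) q I, of x]
  have "(\<lambda>k. m (r * 2 ^ k)) \<longlonglongrightarrow> 0"
    unfolding m_def by (rule filterlim_compose)
  \<comment> \<open>Both dyadic chains start at radius \<open>r\<close>, their term of index 0. The
    outer one ends at 0, the inner one at \<open>u x\<close>.\<close>
  from geometric_increments_limit[OF this far \<theta>(1,2)]
  have b1: "\<bar>m r\<bar> \<le> B / (1 - \<theta>1)" by simp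
  have "(\<lambda>k. r / 2 ^ k) \<longlonglongrightarrow> 0"
    by (rule LIMSEQ_divide_realpow_zero) auto
  then have "filterlim (\<lambda>k. r / 2 ^ k) (at_right 0) sequentially"
    using r by (auto simp: filterlim_at)
  with ball_mean_tendsto_point[OF loc assms(1) _ fin]
  have "(\<lambda>k. m (r / 2 ^ k)) \<longlonglongrightarrow> u x"
    unfolding m_def using s by (auto intro: filterlim_compose)
  from geometric_increments_limit[OF this near \<theta>(3,4)]
  have b2: "\<bar>m r - u x\<bar> \<le> B * 2 ^ n / (1 - \<theta>2)" by simp
  have "\<bar>u x\<bar> \<le> B / (1 - \<theta>1) + B * 2 ^ n / (1 - \<theta>2)"
    using b1 b2 by linarith
  also have "\<dots> = sqrt C0 * (1 / (1 - \<theta>1) + 2 ^ n / (1 - \<theta>2)) * sqrt D * r powr (- \<nu>)"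
    by (simp add: B_def real_sqrt_mult algebra_simps)
  finally show ?thesis
    by (simp add: radial_const_def C0_def \<theta>1_def \<theta>2_def \<nu>_def n_def p_def r_def)
qed

section \<open>Integrals of powers and the normalising constant\<close>

text \<open>The maximum covers both signs of \<open>a\<close>: the power is largest at the outer
  radius for \<open>a \<ge> 0\<close> and at the inner radius otherwise. The shell is simply
  enclosed in a ball.\<close>

lemma shell_powr_integral:
  fixes t a :: real
  assumes t: "t > 0"
  shows "(\<integral>\<^sup>+x. indicator {x::'a::euclidean_space. t \<le> norm x \<and> norm x \<le> 2 * t} x * ennreal (norm x powr a) \<partial>lborel)
     \<le> ennreal (unit_ball_vol DIM('a) * 2 ^ DIM('a) * max 1 (2 powr a) * t powr (a + DIM('a)))"
proof -
  define c where "c = max 1 (2 powr a) * t powr a"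
  have c: "c \<ge> 0" by (simp add: c_def)
  have le: "norm x powr a \<le> c" if "t \<le> norm x" "norm x \<le> 2 * t" for x :: 'a
  proof (cases "a \<ge> 0")
    case True
    then have "norm x powr a \<le> (2 * t) powr a" using that by (intro powr_mono2) auto
    also have "\<dots> = 2 powr a * t powr a" using t by (simp add: powr_mult)
    also have "\<dots> \<le> c" unfolding c_def by (intro mult_right_mono) auto
    finally show ?thesis .
  next
    case False
    then have "norm x powr a \<le> 1 * t powr a" using that t by (simp add: powr_mono2')
    also have "\<dots> \<le> c" unfolding c_def by (intro mult_right_mono) auto
    finally show ?thesis .
  qed
  have "(\<integral>\<^sup>+x. indicator {x::'a. t \<le> norm x \<and> norm x \<le> 2 * t} x * ennreal (norm x powr a) \<partial>lborel)
      \<le> (\<integral>\<^sup>+x. ennreal c * indicator (cball (0::'a) (2 * t)) x \<partial>lborel)"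
    by (intro nn_integral_mono) (auto simp: indicator_def intro!: ennreal_leI le)
  also have "\<dots> = ennreal (c * (unit_ball_vol DIM('a) * (2 * t) ^ DIM('a)))"
    using t c by (subst nn_integral_cmult_indicator) (auto simp: emeasure_cball ennreal_mult)
  also have "c * (unit_ball_vol DIM('a) * (2 * t) ^ DIM('a))
      = unit_ball_vol DIM('a) * 2 ^ DIM('a) * max 1 (2 powr a) * t powr (a + DIM('a))"
    using t by (simp add: c_def power_mult_distrib powr_add powr_realpow)
  finally show ?thesis .
qed

text \<open>Only an upper bound is wanted, so the shells need to cover \<open>A\<close> but may
  overlap.\<close>

lemma dyadic_shells_powr_integral_finite:
  fixes t :: "nat \<Rightarrow> real" and a :: real and A :: "'a::euclidean_space set"
  assumes t: "\<And>k. t k > 0" and sm: "summable (\<lambda>k. t k powr (a + DIM('a)))"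
    and A: "\<And>x. x \<in> A \<Longrightarrow> \<exists>k. t k \<le> norm x \<and> norm x \<le> 2 * t k"
  shows "(\<integral>\<^sup>+x. indicator A x * ennreal (norm x powr a) \<partial>lborel) < \<infinity>"
proof -
  define C where "C = unit_ball_vol DIM('a) * 2 ^ DIM('a) * max 1 (2 powr a)"
  have C: "C \<ge> 0" by (simp add: C_def)
  define f where "f k x = indicator {x::'a. t k \<le> norm x \<and> norm x \<le> 2 * t k} x * ennreal (norm x powr a)" for k x
  have "(\<integral>\<^sup>+x. indicator A x * ennreal (norm x powr a) \<partial>lborel) \<le> (\<integral>\<^sup>+x. (\<Sum>k. f k x) \<partial>lborel)"
  proof (intro nn_integral_mono)
    fix x :: 'a
    show "indicator A x * ennreal (norm x powr a) \<le> (\<Sum>k. f k x)"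
    proof (cases "x \<in> A")
      case True
      then obtain k where "t k \<le> norm x \<and> norm x \<le> 2 * t k" using A by blast
      then have "indicator A x * ennreal (norm x powr a) = sum (\<lambda>k. f k x) {k}"
        using True by (simp add: f_def)
      also have "\<dots> \<le> (\<Sum>k. f k x)" by (rule sum_le_suminf) auto
      finally show ?thesis .
    qed simp
  qed
  also have "\<dots> = (\<Sum>k. \<integral>\<^sup>+x. f k x \<partial>lborel)"
    by (rule nn_integral_suminf) (simp add: f_def)
  also have "\<dots> \<le> (\<Sum>k. ennreal (C * t k powr (a + DIM('a))))"
    unfolding f_def C_def by (intro suminf_le shell_powr_integral t summableI)
  also have "\<dots> = ennreal (\<Sum>k. C * t k powr (a + DIM('a)))"
    using C sm by (intro suminf_ennreal2 summable_mult) auto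
  finally show ?thesis
    by (rule order.strict_trans1) simp
qed

lemma ex_power2_interval:
  fixes y :: real
  assumes "y \<ge> 1"
  shows "\<exists>k. 2 ^ k \<le> y \<and> y \<le> 2 * 2 ^ k"
proof -
  define n where "n = (LEAST n. y < 2 ^ n)"
  have "\<exists>n. y < 2 ^ n" by (rule real_arch_pow) simp
  then have n: "y < 2 ^ n" unfolding n_def by (rule LeastI_ex)
  with assms obtain k where k: "n = Suc k" by (cases n) auto
  have "\<not> y < 2 ^ k" using k unfolding n_def by (intro not_less_Least) simp
  then show ?thesis using n k by (intro exI[of _ k]) auto
qed

lemma powr_integral_outer_finite:
  assumes "a < - real DIM('a::euclidean_space)"
  shows "(\<integral>\<^sup>+x. indicator {x::'a. 1 \<le> norm x} x * ennreal (norm x powr a) \<partial>lborel) < \<infinity>"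
proof (rule dyadic_shells_powr_integral_finite[where t = "\<lambda>k. 2 ^ k"])
  have "(2 ^ k) powr (a + DIM('a)) = (2 powr (a + DIM('a))) ^ k" for k :: nat
    by (simp add: powr_powr powr_power mult.commute flip: powr_realpow)
  moreover have "(2::real) powr (a + DIM('a)) < 1" using assms by (simp add: powr_less_one)
  ultimately show "summable (\<lambda>k. (2 ^ k) powr (a + DIM('a)))"
    by (simp add: summable_geometric)
qed (auto intro: ex_power2_interval)

lemma powr_integral_inner_finite:
  assumes "a > - real DIM('a::euclidean_space)"
  shows "(\<integral>\<^sup>+x. indicator {x::'a. 0 < norm x \<and> norm x \<le> 1} x * ennreal (norm x powr a) \<partial>lborel) < \<infinity>"
proof (rule dyadic_shells_powr_integral_finite[where t = "\<lambda>k. 1 / (2 * 2 ^ k)"])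
  have "(1 / (2 * 2 ^ k)) powr (a + DIM('a)) = (1 / 2) powr (a + DIM('a)) * ((1 / 2) powr (a + DIM('a))) ^ k" for k :: nat
  proof -
    have "1 / (2 * 2 ^ k) = (1 / 2) * (1 / 2 :: real) ^ k" by (simp add: power_one_over)
    then show ?thesis
      by (simp only: powr_mult powr_power) (simp add: powr_powr powr_power mult.commute flip: powr_realpow)
  qed
  moreover have "(1 / 2::real) powr (a + DIM('a)) < 1"
    using assms by (subst powr01_less_one) auto
  ultimately show "summable (\<lambda>k. (1 / (2 * 2 ^ k)) powr (a + DIM('a)))"
    by (simp add: summable_mult summable_geometric)
next
  fix x :: 'a assume "x \<in> {x. 0 < norm x \<and> norm x \<le> 1}"
  then have x: "0 < norm x" "norm x \<le> 1" by auto
  \<comment> \<open>Reciprocals swap the ends of the dyadic interval, hence the extra 2 in the inner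
    radii \<open>1 / (2 * 2 ^ k)\<close>.\<close>
  then obtain k where "2 ^ k \<le> 1 / norm x \<and> 1 / norm x \<le> 2 * 2 ^ k"
    using ex_power2_interval[of "1 / norm x"] by (auto simp: field_simps)
  then show "\<exists>k. 1 / (2 * 2 ^ k) \<le> norm x \<and> norm x \<le> 2 * (1 / (2 * 2 ^ k))"
    using x by (intro exI[of _ k]) (auto simp: field_simps)
qed auto

section \<open>Positivity of the normalising constant\<close>

lemma one_minus_cos_le: "1 - cos t \<le> t\<^sup>2" for t :: real
proof -
  have "1 - cos t = 2 * (sin (t / 2))\<^sup>2"
    using cos_double_sin[of "t / 2"] by simp
  also have "(sin (t / 2))\<^sup>2 \<le> (t / 2)\<^sup>2"
    using abs_sin_x_le_abs_x[of "t / 2"] by (simp only: abs_le_square_iff)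
  finally have "1 - cos t \<le> t\<^sup>2 / 2" by (simp add: power_divide)
  also have "\<dots> \<le> t\<^sup>2" by simp
  finally show ?thesis .
qed

text \<open>\<open>enn2real\<close> sends infinity to 0 and \<open>inverse 0 = 0\<close>, so the
  defining integral must be shown both finite and nonzero.\<close>

lemma CNs_pos:
  assumes s: "0 < s" "s < 1"
  shows "CNs TYPE('a::euclidean_space) s > 0"
proof -
  define b where "b = (SOME b. b \<in> (Basis::'a set))"
  have b: "b \<in> Basis" unfolding b_def by (rule someI_ex) (use nonempty_Basis in blast)
  define p where "p = DIM('a) + 2 * s"
  define f where "f \<zeta> = ennreal ((1 - cos (\<zeta> \<bullet> b)) / norm \<zeta> powr p)" for \<zeta> :: 'a
  have [measurable]: "f \<in> borel_measurable borel" unfolding f_def by measurable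
  let ?g1 = "\<lambda>x::'a. indicator {x. 1 \<le> norm x} x * ennreal (norm x powr (- p))"
  let ?g2 = "\<lambda>x::'a. indicator {x. 0 < norm x \<and> norm x \<le> 1} x * ennreal (norm x powr (2 - p))"
  \<comment> \<open>Outside the unit ball \<open>1 - cos\<close> is at most 2, leaving the exponent
    \<open>- p < - N\<close> since \<open>s > 0\<close>. Inside, the quadratic bound leaves
    \<open>2 - p > - N\<close> since \<open>s < 1\<close>.\<close>
  have "(\<integral>\<^sup>+\<zeta>. f \<zeta> \<partial>lborel) \<le> (\<integral>\<^sup>+\<zeta>. 2 * ?g1 \<zeta> + ?g2 \<zeta> \<partial>lborel)"
  proof (rule nn_integral_mono)
    fix \<zeta> :: 'a
    consider "\<zeta> = 0" | "\<zeta> \<noteq> 0" "norm \<zeta> \<le> 1" | "norm \<zeta> \<ge> 1" by linarith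
    then show "f \<zeta> \<le> 2 * ?g1 \<zeta> + ?g2 \<zeta>"
    proof cases
      case 1
      then show ?thesis by (simp add: f_def)
    next
      case 2
      have "\<bar>\<zeta> \<bullet> b\<bar> \<le> norm \<zeta>" using b by (rule Basis_le_norm)
      then have "1 - cos (\<zeta> \<bullet> b) \<le> (norm \<zeta>)\<^sup>2"
        using one_minus_cos_le[of "\<zeta> \<bullet> b"] abs_le_square_iff[of "\<zeta> \<bullet> b" "norm \<zeta>"] by simp
      then have "(1 - cos (\<zeta> \<bullet> b)) / norm \<zeta> powr p \<le> (norm \<zeta>)\<^sup>2 / norm \<zeta> powr p"
        by (rule divide_right_mono) simp
      also have "\<dots> = norm \<zeta> powr (2 - p)" using 2 by (simp add: powr_diff)
      finally have "f \<zeta> \<le> ?g2 \<zeta>" using 2 by (simp add: f_def ennreal_leI)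
      then show ?thesis by (rule add_increasing[rotated]) simp
    next
      case 3
      have "(1 - cos (\<zeta> \<bullet> b)) / norm \<zeta> powr p \<le> 2 / norm \<zeta> powr p"
        using cos_ge_minus_one[of "\<zeta> \<bullet> b"] by (intro divide_right_mono) auto
      also have "\<dots> = 2 * norm \<zeta> powr (- p)" by (simp add: powr_minus field_simps)
      finally have "f \<zeta> \<le> ennreal (2 * norm \<zeta> powr (- p))"
        unfolding f_def by (rule ennreal_leI)
      also have "\<dots> = 2 * ?g1 \<zeta>" using 3 by (simp add: ennreal_mult)
      finally show ?thesis by (rule add_increasing2[rotated]) simp
    qed
  qed
  also have "\<dots> = 2 * (\<integral>\<^sup>+\<zeta>. ?g1 \<zeta> \<partial>lborel) + (\<integral>\<^sup>+\<zeta>. ?g2 \<zeta> \<partial>lborel)"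
    by (simp add: nn_integral_add nn_integral_cmult)
  also have "\<dots> < \<infinity>"
    using powr_integral_outer_finite[where 'a='a, of "-p"] powr_integral_inner_finite[where 'a='a, of "2-p"] s
    by (simp add: p_def ennreal_mult_less_top)
  finally have fin: "(\<integral>\<^sup>+\<zeta>. f \<zeta> \<partial>lborel) < \<infinity>" .
  have "(\<integral>\<^sup>+\<zeta>. f \<zeta> \<partial>lborel) \<noteq> 0"
  proof
    assume "(\<integral>\<^sup>+\<zeta>. f \<zeta> \<partial>lborel) = 0"
    then have ae: "AE \<zeta> in lborel. f \<zeta> = 0"
      by (subst (asm) nn_integral_0_iff_AE) auto
    \<comment> \<open>On this slab the cosine is strictly below 1, so \<open>f\<close> does not
      vanish; a nonempty open set is not null.\<close>
    define U where "U = {\<zeta>::'a. 0 < \<zeta> \<bullet> b \<and> \<zeta> \<bullet> b < 1}"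
    have U: "open U" unfolding U_def
      by (intro open_Collect_conj open_Collect_less continuous_intros)
    have "(1 / 2) *\<^sub>R b \<in> U" using b by (simp add: U_def)
    then have ne: "U \<noteq> {}" by blast
    have pos: "f \<zeta> \<noteq> 0" if "\<zeta> \<in> U" for \<zeta>
    proof -
      have "cos (\<zeta> \<bullet> b) < cos 0"
        using that pi_gt3 by (intro cos_monotone_0_pi) (auto simp: U_def)
      moreover have "\<zeta> \<noteq> 0" using that by (auto simp: U_def)
      ultimately show ?thesis by (simp add: f_def ennreal_eq_0_iff not_le)
    qed
    have "AE \<zeta> in lborel. \<zeta> \<notin> U"
      using ae by eventually_elim (use pos in auto)
    then have "emeasure lborel U = 0"
      using U by (subst (asm) AE_iff_measurable[of U]) auto
    then show False
      using U ne open_not_negligible[of U] by (auto simp: negligible_iff_null_sets null_sets_completionI)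
  qed
  then have "enn2real (\<integral>\<^sup>+\<zeta>. f \<zeta> \<partial>lborel) > 0"
    using fin by (simp add: enn2real_positive_iff zero_less_iff_neq_zero)
  then show ?thesis
    by (simp add: CNs_def f_def b_def p_def)
qed

section \<open>Decay of the supremum\<close>

lemma gagliardo_sq_eq_energy:
  fixes u :: "'a::euclidean_space \<Rightarrow> real"
  assumes [measurable]: "u \<in> borel_measurable borel"
  shows "gagliardo_sq s u = ennreal (CNs TYPE('a) s / 2) * energy (real DIM('a) + 2 * s) u"
  unfolding gagliardo_sq_def energy_def gag_kernel_def
  by (subst lborel.nn_integral_fst[symmetric]) auto

text \<open>Undoing the normalisation gives the energy bound \<open>2 / C(N,s)\<close>, and the
  critical exponent serves as \<open>q\<close>. The excluded null set consists of the origin and the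
  points where the inner Gagliardo integral is infinite.\<close>

lemma radial_decay_AE:
  fixes u :: "'a::euclidean_space \<Rightarrow> real"
  assumes s: "1/2 < s" "s < 1" and N: "DIM('a) \<ge> 2"
    and u: "radial u" "in_Hdot s u" and le1: "gagliardo_sq s u \<le> 1"
  shows "AE x in lborel. \<bar>u x\<bar> \<le> radial_const TYPE('a) s * sqrt (2 / CNs TYPE('a) s)
     * norm x powr (- ((real DIM('a) - 2 * s) / 2))"
proof -
  define c where "c = CNs TYPE('a) s"
  have c: "c > 0" unfolding c_def using s by (intro CNs_pos) auto
  have N2: "real DIM('a) \<ge> 2" using N by simp
  have [measurable]: "u \<in> borel_measurable borel"
    using u(2) by (simp add: in_Hdot_def)
  define q where "q = frac_crit DIM('a) s"
  have q: "q \<ge> 1" using s N2 by (simp add: q_def frac_crit_def field_simps)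
  have I: "integrable lborel (\<lambda>x. \<bar>u x\<bar> powr q)"
    using u(2) by (intro integrableI_nonneg) (auto simp: in_Hdot_def q_def)
  define p where "p = real DIM('a) + 2 * s"
  have "energy p u = ennreal (2 / c) * (ennreal (c / 2) * energy p u)"
    using c by (simp add: mult.assoc[symmetric] flip: ennreal_mult)
  also have "\<dots> \<le> ennreal (2 / c) * 1"
    using le1 by (intro mult_left_mono) (auto simp: gagliardo_sq_eq_energy c_def p_def)
  finally have E: "energy p u \<le> ennreal (2 / c)" by simp
  then have "energy p u \<noteq> \<infinity>" by (auto simp: top_unique)
  then have "AE x in lborel. (\<integral>\<^sup>+y. ennreal (gag_kernel p u x y) \<partial>lborel) \<noteq> \<infinity>"
    unfolding energy_def by (intro nn_integral_PInf_AE) auto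
  moreover have "AE x in lborel. x \<noteq> (0::'a)"
    by (rule AE_lborel_singleton)
  ultimately show ?thesis
  proof eventually_elim
    case (elim x)
    then show ?case
      using radial_pointwise_bound[OF _ u(1) q I s(1) _ E[unfolded p_def]] s N2 c
      by (simp add: c_def p_def less_top)
  qed
qed

text \<open>Weighted AM-GM with weights \<beta> and 1 - \<beta> plays the role of Hoelder's inequality and
  covers the endpoints \<beta> = 0 and \<beta> = 1 as well.\<close>

lemma integrand_bound:
  fixes t M r R V0 K0 B \<alpha> \<beta> \<nu> \<tau> q n W :: real
  assumes r: "1 \<le> R" "R \<le> r" and \<beta>: "0 \<le> \<beta>" "\<beta> \<le> 1" and q: "2 * \<beta> < q" and V0: "0 \<le> V0"
    and W: "W = (if \<beta> = 0 then 1 else V0 powr \<beta>)" "W > 0" and B: "0 \<le> B"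
    and K0: "K0 \<le> B * (r powr \<alpha> * W)" and t: "\<bar>t\<bar> \<le> M * r powr (- \<nu>)" and M: "0 \<le> M"
    and \<tau>: "0 \<le> \<tau>" "\<alpha> - \<nu> * (q - 2 * \<beta>) = - n * (1 - \<beta>) - 2 * \<tau>"
  shows "K0 * \<bar>t\<bar> powr q \<le> B * M powr (q - 2 * \<beta>) * R powr (- \<tau>) * (V0 * t\<^sup>2 + r powr (- n - \<tau>))"
proof (cases "t = 0")
  case True
  then show ?thesis using B M by simp
next
  case False
  define e where "e = q - 2 * \<beta>"
  define h where "h = r powr (- n - \<tau>)"
  have h: "h > 0" using r by (simp add: h_def)
  have young: "W * \<bar>t\<bar> powr (2 * \<beta>) * h powr (1 - \<beta>) \<le> V0 * t\<^sup>2 + h"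
  proof (cases "\<beta> = 0")
    case True
    then show ?thesis using False V0 h by (simp add: W)
  next
    case \<beta>0: False
    \<comment> \<open>As \<open>0 powr \<beta> = 0\<close>, positivity of \<open>W\<close> rules out
      \<open>V0 = 0\<close>.\<close>
    then have "V0 > 0" using W V0 by (cases "V0 = 0") auto
    then have pos: "V0 * t\<^sup>2 > 0" using False by simp
    have "\<bar>t\<bar> powr (2 * \<beta>) = (t\<^sup>2) powr \<beta>"
      using powr_powr[of "\<bar>t\<bar>" 2 \<beta>] False by simp
    then have "W * \<bar>t\<bar> powr (2 * \<beta>) = (V0 * t\<^sup>2) powr \<beta>"
      using \<beta>0 V0 by (simp add: W powr_mult)
    then have "W * \<bar>t\<bar> powr (2 * \<beta>) * h powr (1 - \<beta>) \<le> \<beta> * (V0 * t\<^sup>2) + (1 - \<beta>) * h"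
      using Youngs_inequality_0[OF \<beta>(1) _ _ pos h, of "1 - \<beta>"] \<beta> by simp
    also have "\<dots> \<le> 1 * (V0 * t\<^sup>2) + 1 * h"
      using \<beta> pos h by (intro add_mono mult_right_mono) auto
    finally show ?thesis by simp
  qed
  have "r powr \<alpha> * \<bar>t\<bar> powr e \<le> r powr \<alpha> * (M * r powr (- \<nu>)) powr e"
    using q t by (intro mult_left_mono powr_mono2) (auto simp: e_def)
  also have "\<dots> = M powr e * (r powr \<alpha> * r powr (- \<nu> * e))"
    using M by (simp add: powr_mult powr_powr)
  also have "\<dots> = M powr e * r powr (\<alpha> - \<nu> * e)"
    by (simp flip: powr_add)
  \<comment> \<open>The right exponent exceeds the left one by \<open>\<tau> * \<beta>\<close>, and
    \<open>r \<ge> 1\<close>. Of the surplus \<open>2 * \<tau>\<close>, one half is kept for decay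
    in \<open>R\<close>; the other goes into \<open>h\<close> and makes it integrable at
    infinity.\<close>
  also have "r powr (\<alpha> - \<nu> * e) \<le> r powr (- \<tau> + (- n - \<tau>) * (1 - \<beta>))"
  proof (rule powr_mono)
    have "0 \<le> \<tau> * \<beta>" using \<tau> \<beta> by simp
    then show "\<alpha> - \<nu> * e \<le> - \<tau> + (- n - \<tau>) * (1 - \<beta>)"
      unfolding e_def \<tau>(2) by (simp add: algebra_simps)
  qed (use r in auto)
  also have "\<dots> = r powr (- \<tau>) * h powr (1 - \<beta>)"
    by (simp add: h_def powr_powr flip: powr_add)
  also have "\<dots> \<le> R powr (- \<tau>) * h powr (1 - \<beta>)"
    using r \<tau> by (intro mult_right_mono powr_mono2') auto
  finally have rt: "r powr \<alpha> * \<bar>t\<bar> powr e \<le> M powr e * (R powr (- \<tau>) * h powr (1 - \<beta>))"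
    by (simp add: mult_left_mono)
  have tq: "\<bar>t\<bar> powr q = \<bar>t\<bar> powr (2 * \<beta>) * \<bar>t\<bar> powr e"
    by (simp add: e_def flip: powr_add)
  have "K0 * \<bar>t\<bar> powr q \<le> B * (r powr \<alpha> * W) * \<bar>t\<bar> powr q"
    using K0 by (intro mult_right_mono) auto
  also have "\<dots> = B * W * \<bar>t\<bar> powr (2 * \<beta>) * (r powr \<alpha> * \<bar>t\<bar> powr e)"
    by (simp add: tq ac_simps)
  also have "\<dots> \<le> B * W * \<bar>t\<bar> powr (2 * \<beta>) * (M powr e * (R powr (- \<tau>) * h powr (1 - \<beta>)))"
    using B W by (intro mult_left_mono rt) auto
  also have "\<dots> = B * M powr e * R powr (- \<tau>) * (W * \<bar>t\<bar> powr (2 * \<beta>) * h powr (1 - \<beta>))"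
    by (simp add: ac_simps)
  also have "\<dots> \<le> B * M powr e * R powr (- \<tau>) * (V0 * t\<^sup>2 + h)"
    using B by (intro mult_left_mono young) auto
  finally show ?thesis by (simp add: e_def h_def)
qed

theorem theorem4p5:
  fixes V K :: "real \<Rightarrow> real" and s \<alpha>inf \<beta>inf R2 q2 :: real
  assumes "DIM('a::euclidean_space) \<ge> 2"
    and "1/2 < s" and "s < 1"
    and "continuous_on {0<..} V" and "\<forall>r>0. V r \<ge> 0"
    and "continuous_on {0<..} K" and "\<forall>r>0. K r > 0"
    and "R2 > 0" and "0 \<le> \<beta>inf" and "\<beta>inf \<le> 1"
    and "\<forall>r>R2. vpow V \<beta>inf r > 0"
    and "bdd_above ((\<lambda>r. K r / (r powr \<alpha>inf * vpow V \<beta>inf r)) ` {R2<..})"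
    and "q2 > max 1 (max (2 * \<beta>inf) (qstar DIM('a) \<alpha>inf \<beta>inf s))"
  shows "((\<lambda>R. S_inf TYPE('a) V K s q2 R) \<longlongrightarrow> 0) at_top"
proof -
  define n where "n = real DIM('a)"
  define \<nu> where "\<nu> = (n - 2 * s) / 2"
  define e where "e = q2 - 2 * \<beta>inf"
  \<comment> \<open>Solved from the exponent identity in \<open>integrand_bound\<close>. It equals
    half of \<open>q2 * \<nu> - (\<alpha>inf - 2 * s * \<beta>inf + n)\<close>, so it is positive
    exactly when \<open>q2\<close> exceeds \<open>qstar\<close>.\<close>
  define \<tau> where "\<tau> = (- n * (1 - \<beta>inf) - (\<alpha>inf - \<nu> * e)) / 2"
  define M where "M = radial_const TYPE('a) s * sqrt (2 / CNs TYPE('a) s)"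
  have n: "n \<ge> 2" using assms(1) by (simp add: n_def)
  have \<nu>: "\<nu> > 0" using n assms(3) by (simp add: \<nu>_def)
  have q2: "q2 > 2 * \<beta>inf" "q2 > qstar DIM('a) \<alpha>inf \<beta>inf s" using assms(13) by auto
  have "\<alpha>inf - 2 * s * \<beta>inf + n < q2 * \<nu>"
    using q2(2) \<nu> by (simp add: qstar_def \<nu>_def n_def field_simps)
  then have \<tau>: "\<tau> > 0"
    by (simp add: \<tau>_def e_def \<nu>_def field_simps)
  have CN: "CNs TYPE('a) s > 0" using assms(2,3) by (intro CNs_pos) auto
  have M: "M \<ge> 0"
    unfolding M_def radial_const_def using CN \<nu> assms(2)
    by (intro mult_nonneg_nonneg add_nonneg_nonneg divide_nonneg_nonneg)
       (auto simp: \<nu>_def n_def intro!: less_imp_le powr_less_one)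
  obtain B0 where B0: "\<And>r. r > R2 \<Longrightarrow> K r / (r powr \<alpha>inf * vpow V \<beta>inf r) \<le> B0"
    using assms(12) by (auto simp: bdd_above_def)
  define B where "B = max 0 B0"
  have KB: "K r \<le> B * (r powr \<alpha>inf * vpow V \<beta>inf r)" if "r > R2" for r
  proof -
    have pos: "r powr \<alpha>inf * vpow V \<beta>inf r > 0" using that assms(8,11) by simp
    have "K r / (r powr \<alpha>inf * vpow V \<beta>inf r) \<le> B" using B0[OF that] by (simp add: B_def)
    then show ?thesis using pos by (simp add: pos_divide_le_eq)
  qed
  let ?g = "\<lambda>x::'a. indicator {x. 1 \<le> norm x} x * ennreal (norm x powr (- n - \<tau>))"
  have "(\<integral>\<^sup>+x. ?g x \<partial>lborel) < \<infinity>"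
    using \<tau> by (intro powr_integral_outer_finite) (simp add: n_def)
  then obtain T where T: "(\<integral>\<^sup>+x. ?g x \<partial>lborel) = ennreal T" "T \<ge> 0"
    by (cases "\<integral>\<^sup>+x. ?g x \<partial>lborel" rule: ennreal_cases) auto
  define C where "C R = B * M powr e * R powr (- \<tau>)" for R
  have C: "C R \<ge> 0" for R by (simp add: C_def B_def)
  \<comment> \<open>\<open>R > 1\<close> serves the pointwise bound and the cut-off in
    \<open>?g\<close>; \<open>R > R2\<close> makes the bound on \<open>K\<close> available.\<close>
  have bound: "S_inf TYPE('a) V K s q2 R \<le> ennreal (C R * (1 + T))" if R: "R > max 1 R2" for R
    unfolding S_inf_def
  proof (rule Sup_least, clarify)
    fix u :: "'a \<Rightarrow> real"
    assume u: "radial u" "in_HsV V s u" "HsV_normsq V s u = 1"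
    have [measurable]: "u \<in> borel_measurable borel"
      using u(2) by (simp add: in_HsV_def in_Hdot_def)
    have le1: "gagliardo_sq s u \<le> 1" "V_part V u \<le> 1"
      using u(3) unfolding HsV_normsq_def by (metis le_iff_add add.commute)+
    \<comment> \<open>\<open>V\<close> is continuous only on the open half-line, so measurability is
      obtained for its cut-off away from the origin. It is needed to split the integral of
      \<open>?h + ?g\<close>.\<close>
    have "continuous_on {x::'a. 1 \<le> norm x} (\<lambda>x. V (norm x))"
      by (rule continuous_on_compose2[OF assms(4)]) (auto intro!: continuous_intros)
    then have "(\<lambda>x::'a. indicator {x. 1 \<le> norm x} x *\<^sub>R V (norm x)) \<in> borel_measurable borel"
      by (intro borel_measurable_continuous_on_indicator) auto
    then have [measurable]: "(\<lambda>x::'a. indicator {x. 1 \<le> norm x} x * V (norm x)) \<in> borel_measurable borel"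
      by simp
    let ?h = "\<lambda>x::'a. ennreal (indicator {x. 1 \<le> norm x} x * V (norm x) * (u x)\<^sup>2)"
    have [measurable]: "?h \<in> borel_measurable borel"
      by measurable
    have "AE x in lborel. \<bar>u x\<bar> \<le> M * norm x powr (- \<nu>)"
      unfolding M_def \<nu>_def n_def using u le1 assms(1-3)
      by (intro radial_decay_AE) (auto simp: in_HsV_def)
    then have "AE x in lborel. ennreal (indicator {x. R \<le> norm x} x * K (norm x) * \<bar>u x\<bar> powr q2)
        \<le> ennreal (C R) * (?h x + ?g x)"
    proof eventually_elim
      case (elim x)
      show ?case
      proof (cases "R \<le> norm x")
        case True
        then have x: "1 \<le> norm x" "R2 < norm x" "0 < norm x" using R by auto
        have "K (norm x) * \<bar>u x\<bar> powr q2 \<le> C R * (V (norm x) * (u x)\<^sup>2 + norm x powr (- n - \<tau>))"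
          unfolding C_def e_def
        proof (rule integrand_bound)
          show "\<alpha>inf - \<nu> * (q2 - 2 * \<beta>inf) = - n * (1 - \<beta>inf) - 2 * \<tau>"
            by (simp add: \<tau>_def e_def field_simps)
          show "K (norm x) \<le> B * (norm x powr \<alpha>inf * vpow V \<beta>inf (norm x))"
            using KB x by simp
        qed (use R True x assms q2 elim M \<tau> in \<open>auto simp: vpow_def B_def\<close>)
        then have "ennreal (K (norm x) * \<bar>u x\<bar> powr q2)
          \<le> ennreal (C R * (V (norm x) * (u x)\<^sup>2 + norm x powr (- n - \<tau>)))"
          by (rule ennreal_leI)
        also have "\<dots> = ennreal (C R) * (?h x + ?g x)"
          using C x assms(5) by (simp add: ennreal_mult ennreal_plus)
        finally show ?thesis using True by simp
      qed simp
    qed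
    then have "(\<integral>\<^sup>+x. ennreal (indicator {x. R \<le> norm x} x * K (norm x) * \<bar>u x\<bar> powr q2) \<partial>lborel)
        \<le> (\<integral>\<^sup>+x. ennreal (C R) * (?h x + ?g x) \<partial>lborel)"
      by (rule nn_integral_mono_AE)
    also have "\<dots> = ennreal (C R) * ((\<integral>\<^sup>+x. ?h x \<partial>lborel) + ennreal T)"
      by (simp add: nn_integral_cmult nn_integral_add T)
    also have "\<dots> \<le> ennreal (C R) * (V_part V u + ennreal T)"
      unfolding V_part_def
      by (intro mult_left_mono add_right_mono nn_integral_mono) (auto simp: indicator_def)
    also have "\<dots> \<le> ennreal (C R) * (1 + ennreal T)"
      by (intro mult_left_mono add_right_mono le1) auto
    also have "\<dots> = ennreal (C R * (1 + T))"
      using C T by (simp add: ennreal_mult ennreal_plus)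
    finally show "(\<integral>\<^sup>+x. ennreal (indicator {x. R \<le> norm x} x * K (norm x) * \<bar>u x\<bar> powr q2) \<partial>lborel)
        \<le> ennreal (C R * (1 + T))" .
  qed
  have "((\<lambda>R. B * M powr e * R powr (- \<tau>) * (1 + T)) \<longlongrightarrow> B * M powr e * 0 * (1 + T)) at_top"
    using \<tau> by (intro tendsto_mult tendsto_const tendsto_neg_powr filterlim_ident) auto
  then have "((\<lambda>R. ennreal (C R * (1 + T))) \<longlongrightarrow> ennreal 0) at_top"
    by (intro tendsto_ennrealI) (simp add: C_def)
  then have lim: "((\<lambda>R. ennreal (C R * (1 + T))) \<longlongrightarrow> 0) at_top" by simp
  show ?thesis
  proof (rule tendsto_sandwich[OF _ _ tendsto_const lim])
    show "\<forall>\<^sub>F R in at_top. S_inf TYPE('a) V K s q2 R \<le> ennreal (C R * (1 + T))"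
      using eventually_gt_at_top[of "max 1 R2"] by eventually_elim (rule bound)
  qed simp
qed

end
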